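(* Let $G$ be a connected bipartite graph with $n\ge 2$ vertices, $m$ edges and Randi\'c index $R=R(G)$. Then $$EE(G) \ge 2\cosh\left(\frac{m}{R}\right) + (n-2),$$ with equality if and only if $G$ is isomorphic to a complete bipartite graph $K_{p,q}$ with $p+q=n$.
   Context: All graphs are finite, simple and undirected. For a graph $G$ with adjacency matrix $A(G)$ having eigenvalues $\lambda_1\ge\cdots\ge\lambda_n$, the Estrada index is $EE(G)=\sum_{i=1}^n e^{\lambda_i}$. Writing $d(i)$ for the degree of vertex $i$ and $\mathcal{E}(G)$ for the edge set, the Randi\'c index is $R(G)=\sum_{ij\in\mathcal{E}(G)}(d(i)d(j))^{-1/2}$. $K_{p,q}$ ($p,q\ge1$) is the complete bipartite graph with parts of sizes $p$ and $q$. *)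

theory Defs
  imports "Jordan_Normal_Form.Matrix" "Jordan_Normal_Form.Char_Poly"
    "HOL-Computational_Algebra.Polynomial"
begin

definition simple_graph :: "nat \<Rightarrow> (nat \<Rightarrow> nat \<Rightarrow> bool) \<Rightarrow> bool" where
  "simple_graph n E \<longleftrightarrow> (\<forall>i j. E i j \<longrightarrow> i < n \<and> j < n \<and> i \<noteq> j \<and> E j i)"

definition edges :: "nat \<Rightarrow> (nat \<Rightarrow> nat \<Rightarrow> bool) \<Rightarrow> (nat \<times> nat) set" where
  "edges n E = {(i, j). i < j \<and> j < n \<and> E i j}"

definition num_edges :: "nat \<Rightarrow> (nat \<Rightarrow> nat \<Rightarrow> bool) \<Rightarrow> nat" where
  "num_edges n E = card (edges n E)"

definition vdeg :: "nat \<Rightarrow> (nat \<Rightarrow> nat \<Rightarrow> bool) \<Rightarrow> nat \<Rightarrow> nat" where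
  "vdeg n E i = card {j. j < n \<and> E i j}"

definition randic_index :: "nat \<Rightarrow> (nat \<Rightarrow> nat \<Rightarrow> bool) \<Rightarrow> real" where
  "randic_index n E = (\<Sum>(i, j)\<in>edges n E. 1 / sqrt (real (vdeg n E i * vdeg n E j)))"

definition adj_matrix :: "nat \<Rightarrow> (nat \<Rightarrow> nat \<Rightarrow> bool) \<Rightarrow> real mat" where
  "adj_matrix n E = mat n n (\<lambda>(i, j). if E i j then 1 else 0)"

text \<open>Eigenvalues of the adjacency matrix, with multiplicity: the roots of its
  characteristic polynomial (the matrix is real symmetric, so the characteristic
  polynomial splits over the reals and this multiset has exactly n elements).\<close>
definition adj_eigenvalues :: "nat \<Rightarrow> (nat \<Rightarrow> nat \<Rightarrow> bool) \<Rightarrow> real multiset" where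
  "adj_eigenvalues n E = proots (char_poly (adj_matrix n E))"

definition estrada_index :: "nat \<Rightarrow> (nat \<Rightarrow> nat \<Rightarrow> bool) \<Rightarrow> real" where
  "estrada_index n E = (\<Sum>x\<in>#adj_eigenvalues n E. exp x)"

definition connected_graph :: "nat \<Rightarrow> (nat \<Rightarrow> nat \<Rightarrow> bool) \<Rightarrow> bool" where
  "connected_graph n E \<longleftrightarrow> (\<forall>i<n. \<forall>j<n. E\<^sup>*\<^sup>* i j)"

definition bipartite_graph :: "nat \<Rightarrow> (nat \<Rightarrow> nat \<Rightarrow> bool) \<Rightarrow> bool" where
  "bipartite_graph n E \<longleftrightarrow>
     (\<exists>X. \<forall>i j. E i j \<longrightarrow> (i \<in> X \<longleftrightarrow> j \<notin> X))"

definition complete_bipartite :: "nat \<Rightarrow> nat \<Rightarrow> nat \<Rightarrow> nat \<Rightarrow> bool" where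
  "complete_bipartite p q i j \<longleftrightarrow>
     i < p + q \<and> j < p + q \<and> ((i < p \<and> p \<le> j) \<or> (j < p \<and> p \<le> i))"

definition graph_iso ::
  "nat \<Rightarrow> (nat \<Rightarrow> nat \<Rightarrow> bool) \<Rightarrow> nat \<Rightarrow> (nat \<Rightarrow> nat \<Rightarrow> bool) \<Rightarrow> bool" where
  "graph_iso n E n' E' \<longleftrightarrow>
     (\<exists>f. bij_betw f {0..<n} {0..<n'} \<and> (\<forall>i<n. \<forall>j<n. E i j \<longleftrightarrow> E' (f i) (f j)))"

end

theory Submission
  imports Defs "Jordan_Normal_Form.Schur_Decomposition" "HOL-Analysis.Convex"
begin

text \<open>
  The adjacency matrix A is real symmetric, so its characteristic polynomial splits over the reals,
  and since G is bipartite the spectrum is symmetric about 0; hence EE is the sum of the cosh of the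
  eigenvalues. Testing A against the vector of square roots of the degrees gives an eigenvalue of
  absolute value at least t = m / R. It occurs with both signs, and the other n - 2 eigenvalues
  contribute at least cosh 0 = 1 each, which is the bound.

  Equality forces the spectrum to be t, -t and zeros, so that the cube of A is t^2 A (the squared
  Frobenius norm of the difference is the sum of (e^3 - t^2 e)^2 over the eigenvalues e). Then the
  ends of every walk of length three are adjacent, and a connected bipartite graph with this property is
  complete bipartite. Conversely, for K_{p,q} the cube of A is pq A and the squares of the eigenvalues
  sum to 2pq, which determines the sum of the cosh because cosh e is affine in e^2 on the possible
  eigenvalues 0, sqrt (pq), -sqrt (pq).
\<close>

unbundle no inner_syntax

section \<open>Traces and spectra of real symmetric matrices\<close>

lemma symmetric_mat_index:
  assumes "A \<in> carrier_mat n n" "transpose_mat A = A" "i < n" "j < n"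
  shows "A $$ (j, i) = A $$ (i, j)"
  using assms by (metis carrier_matD index_transpose_mat(1))

text \<open>For an eigenvector \<open>v\<close>, the Hermitian form \<open>q\<close> of
  \<open>A\<close> at \<open>v\<close> equals \<open>z\<close> times the squared norm of
  \<open>v\<close>. Symmetry of the real matrix makes \<open>q\<close> equal to its own conjugate,
  so \<open>z\<close> is a quotient of reals.\<close>

lemma symmetric_mat_eigenvalue_real:
  fixes A :: "real mat" and z :: complex
  assumes A: "A \<in> carrier_mat n n" and sym: "transpose_mat A = A"
    and ev: "eigenvalue (map_mat complex_of_real A) z"
  shows "z \<in> \<real>"
proof -
  let ?B = "map_mat complex_of_real A"
  from ev A obtain v where v: "v \<in> carrier_vec n" "v \<noteq> 0\<^sub>v n" and Bv: "?B *\<^sub>v v = z \<cdot>\<^sub>v v"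
    unfolding eigenvalue_def eigenvector_def by auto
  note A_sym = symmetric_mat_index[OF A sym]
  have row: "(\<Sum>j<n. of_real (A $$ (i, j)) * v $ j) = z * v $ i" if "i < n" for i
  proof -
    have "(?B *\<^sub>v v) $ i = (\<Sum>j<n. of_real (A $$ (i, j)) * v $ j)"
      using that A v(1) by (simp add: scalar_prod_def atLeast0LessThan)
    then show ?thesis using that v(1) by (simp add: Bv)
  qed
  define q where "q = (\<Sum>i<n. \<Sum>j<n. cnj (v $ i) * of_real (A $$ (i, j)) * v $ j)"
  have "q = (\<Sum>i<n. cnj (v $ i) * (z * v $ i))"
    unfolding q_def by (intro sum.cong) (simp_all add: row[symmetric] sum_distrib_left mult.assoc)
  also have "\<dots> = z * of_real (\<Sum>i<n. (cmod (v $ i))\<^sup>2)"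
    by (simp add: sum_distrib_left complex_norm_square mult_ac del: of_real_power)
  finally have q: "q = z * of_real (\<Sum>i<n. (cmod (v $ i))\<^sup>2)" .
  have "cnj q = (\<Sum>i<n. \<Sum>j<n. v $ i * of_real (A $$ (i, j)) * cnj (v $ j))"
    by (simp add: q_def)
  also have "\<dots> = (\<Sum>j<n. \<Sum>i<n. v $ i * of_real (A $$ (i, j)) * cnj (v $ j))"
    by (rule sum.swap)
  also have "\<dots> = q"
    unfolding q_def by (intro sum.cong) (simp_all add: A_sym)
  finally have "q \<in> \<real>" by (simp add: Reals_cnj_iff)
  moreover obtain i where "i < n" "v $ i \<noteq> 0" using v by (metis carrier_vecD eq_vecI index_zero_vec)
  then have "(\<Sum>i<n. (cmod (v $ i))\<^sup>2) > 0"
    by (intro sum_pos2[of _ i]) auto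
  ultimately show ?thesis
    using q by (metis Reals_divide Reals_of_real less_irrefl nonzero_mult_div_cancel_right of_real_eq_0_iff)
qed

text \<open>Factor over the complex numbers, note that all roots are real, and pull the
  factorization back along the injective embedding of real polynomials. The list \<open>es\<close>
  is the form of the spectrum that Schur decomposition takes as input.\<close>

lemma symmetric_mat_char_poly_splits:
  fixes A :: "real mat"
  assumes A: "A \<in> carrier_mat n n" and sym: "transpose_mat A = A"
  obtains es where "char_poly A = (\<Prod>e\<leftarrow>es. [:- e, 1:])" and "length es = n"
proof -
  let ?B = "map_mat complex_of_real A"
  have B: "?B \<in> carrier_mat n n" using A by simp
  from char_poly_factorized[OF B] obtain as where
    as: "char_poly ?B = (\<Prod>a\<leftarrow>as. [:- a, 1:])" and len: "length as = n" by blast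
  have "a \<in> \<real>" if "a \<in> set as" for a
  proof -
    have "poly (char_poly ?B) a = 0"
      using that unfolding as by (auto simp: poly_prod_list prod_list_zero_iff image_iff o_def intro!: bexI[of _ a])
    then show ?thesis
      using symmetric_mat_eigenvalue_real[OF A sym] eigenvalue_root_char_poly[OF B] by blast
  qed
  then have Re: "map (complex_of_real \<circ> Re) as = as"
    by (intro map_idI) (auto simp: of_real_Re)
  let ?es = "map Re as"
  interpret poly_of_real: map_poly_inj_comm_ring_hom complex_of_real ..
  have "map_poly complex_of_real (char_poly A) = (\<Prod>a\<leftarrow>map (complex_of_real \<circ> Re) as. [:- a, 1:])"
    unfolding Re by (simp add: of_real_hom.char_poly_hom[OF A, symmetric] as)
  also have "\<dots> = map_poly complex_of_real (\<Prod>e\<leftarrow>?es. [:- e, 1:])"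
    by (simp add: poly_of_real.hom_prod_list o_def)
  finally have "char_poly A = (\<Prod>e\<leftarrow>?es. [:- e, 1:])"
    by simp
  then show ?thesis using that[of ?es] len by simp
qed

lemma proots_prod_linear_factors:
  "proots (\<Prod>e\<leftarrow>es. [:- e, 1:]) = mset (es :: 'a :: idom list)"
proof (induction es)
  case (Cons e es)
  have "proots ([:- e, 1:] * (\<Prod>e\<leftarrow>es. [:- e, 1:])) = {#e#} + proots (\<Prod>e\<leftarrow>es. [:- e, 1:])"
    by (subst proots_mult) (auto simp: prod_list_zero_iff)
  then show ?case using Cons by (simp del: mult_pCons_left)
qed simp

section \<open>Traces of powers as power sums of the eigenvalues\<close>

definition mat_trace :: "'a :: comm_monoid_add mat \<Rightarrow> 'a" where
  "mat_trace M = (\<Sum>i<dim_row M. M $$ (i, i))"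

lemma mat_trace_mult:
  fixes A B :: "'a :: comm_semiring_0 mat"
  assumes "A \<in> carrier_mat n m" "B \<in> carrier_mat m n"
  shows "mat_trace (A * B) = (\<Sum>i<n. \<Sum>j<m. A $$ (i, j) * B $$ (j, i))"
  using assms by (simp add: mat_trace_def scalar_prod_def atLeast0LessThan)

lemma mat_trace_mult_commute:
  fixes A B :: "'a :: comm_semiring_0 mat"
  assumes "A \<in> carrier_mat n m" "B \<in> carrier_mat m n"
  shows "mat_trace (A * B) = mat_trace (B * A)"
  unfolding mat_trace_mult[OF assms] mat_trace_mult[OF assms(2,1)]
  by (subst sum.swap) (simp add: mult.commute)

lemma mat_trace_similar:
  fixes A B :: "'a :: comm_ring_1 mat"
  assumes "similar_mat A B"
  shows "mat_trace A = mat_trace B"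
proof -
  from similar_matD[OF assms] obtain n P Q where
    carr: "A \<in> carrier_mat n n" "B \<in> carrier_mat n n" "P \<in> carrier_mat n n" "Q \<in> carrier_mat n n"
    and QP: "Q * P = 1\<^sub>m n" and A: "A = P * B * Q"
    by auto
  have "mat_trace A = mat_trace (P * (B * Q))"
    unfolding A using carr by simp
  also have "\<dots> = mat_trace (B * Q * P)"
    using carr by (intro mat_trace_mult_commute) auto
  also have "B * Q * P = B"
    using carr QP by (simp add: assoc_mult_mat[of _ n n _ n _ n])
  finally show ?thesis .
qed

lemma upper_triangular_mult:
  fixes A B :: "'a :: semiring_0 mat"
  assumes A: "A \<in> carrier_mat n n" "upper_triangular A"
    and B: "B \<in> carrier_mat n n" "upper_triangular B"
  shows "upper_triangular (A * B)"
    and "i < n \<Longrightarrow> (A * B) $$ (i, i) = A $$ (i, i) * B $$ (i, i)"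
proof -
  \<comment> \<open>On or below the diagonal a nonzero term needs \<open>i \<le> k\<close> and
    \<open>k \<le> j\<close>, which with \<open>j \<le> i\<close> leaves only
    \<open>k = i = j\<close>.\<close>
  have zero: "A $$ (i, k) * B $$ (k, j) = 0" if "i < n" "j \<le> i" "k < n" "k \<noteq> i \<or> j < i" for i j k
  proof (cases "k < i")
    case True
    then show ?thesis using A that by (auto simp: upper_triangular_def)
  next
    case False
    then have "j < k" using that by auto
    then show ?thesis using B that by (auto simp: upper_triangular_def)
  qed
  have entry: "(A * B) $$ (i, j) = (\<Sum>k<n. A $$ (i, k) * B $$ (k, j))" if "i < n" "j < n" for i j
    using A B that by (simp add: scalar_prod_def atLeast0LessThan)
  show "upper_triangular (A * B)"
    using A B by (auto simp: entry zero intro!: upper_triangularI sum.neutral)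
  show "(A * B) $$ (i, i) = A $$ (i, i) * B $$ (i, i)" if "i < n"
  proof -
    have "(A * B) $$ (i, i) = (\<Sum>k<n. if k = i then A $$ (i, i) * B $$ (i, i) else 0)"
      unfolding entry[OF that that] by (intro sum.cong) (auto simp: zero that)
    then show ?thesis using that by simp
  qed
qed

lemma upper_triangular_pow:
  fixes A :: "'a :: semiring_1 mat"
  assumes A: "A \<in> carrier_mat n n" "upper_triangular A"
  shows "upper_triangular (A ^\<^sub>m k)"
    and "i < n \<Longrightarrow> (A ^\<^sub>m k) $$ (i, i) = A $$ (i, i) ^ k"
proof (induction k)
  case 0
  {
    case 1
    show ?case using A by auto
  next
    case 2
    then show ?case using A by simp
  }
next
  case (Suc k)
  {
    case 1
    show ?case using upper_triangular_mult(1)[OF pow_carrier_mat[OF A(1)] Suc(1) A] by simp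
  next
    case 2
    then show ?case
      using upper_triangular_mult(2)[OF pow_carrier_mat[OF A(1)] Suc(1) A 2] Suc(2)
      by (simp add: power_commutes)
  }
qed

text \<open>Schur decomposition makes \<open>A\<close> similar to a triangular matrix with diagonal
  \<open>es\<close>. Similarity passes to powers and preserves the trace, and powers of a triangular
  matrix act entrywise on its diagonal.\<close>

lemma mat_trace_pow:
  fixes A :: "'a :: conjugatable_ordered_field mat"
  assumes A: "A \<in> carrier_mat n n" and es: "char_poly A = (\<Prod>e\<leftarrow>es. [:- e, 1:])"
  shows "mat_trace (A ^\<^sub>m k) = (\<Sum>e\<leftarrow>es. e ^ k)"
proof -
  obtain B P Q where "schur_decomposition A es = (B, P, Q)"
    by (metis prod_cases3)
  from schur_decomposition[OF A es this]
  have sim: "similar_mat_wit A B P Q" and ut: "upper_triangular B" and diag: "diag_mat B = es"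
    by auto
  have B: "B \<in> carrier_mat n n" using similar_mat_witD2[OF A sim] by simp
  have "mat_trace (A ^\<^sub>m k) = mat_trace (B ^\<^sub>m k)"
    using similar_mat_wit_pow[OF sim] by (intro mat_trace_similar) (auto simp: similar_mat_def)
  also have "\<dots> = (\<Sum>i<n. B $$ (i, i) ^ k)"
    unfolding mat_trace_def using B by (intro sum.cong) (auto simp: upper_triangular_pow(2)[OF B ut])
  also have "\<dots> = (\<Sum>e\<leftarrow>es. e ^ k)"
    using B by (simp add: diag[symmetric] diag_mat_def o_def sum_list_sum_nth atLeast0LessThan)
  finally show ?thesis .
qed

lemma proots_char_poly_uminus:
  fixes A :: "'a :: conjugatable_ordered_field mat"
  assumes A: "A \<in> carrier_mat n n" and es: "char_poly A = (\<Prod>e\<leftarrow>es. [:- e, 1:])"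
  shows "proots (char_poly (-A)) = image_mset uminus (proots (char_poly A))"
proof -
  obtain B where B: "B \<in> carrier_mat n n" and ut: "upper_triangular B" and sim: "similar_mat A B"
    using schur_decomposition_exists[OF A es] by blast
  have neg: "- M = (-1) \<cdot>\<^sub>m M" for M :: "'a mat"
    by (intro eq_matI) auto
  have "char_poly (- A) = char_poly (- B)"
    unfolding neg by (intro char_poly_similar similar_mat_smult sim)
  also have "\<dots> = (\<Prod>e\<leftarrow>map uminus (diag_mat B). [:- e, 1:])"
  proof -
    have "upper_triangular (- B)" using ut B by (auto simp: upper_triangular_def)
    moreover have "diag_mat (- B) = map uminus (diag_mat B)"
      using B by (auto simp: diag_mat_def)
    ultimately show ?thesis using char_poly_upper_triangular[of "- B" n] B by simp
  qed
  finally have "proots (char_poly (-A)) = image_mset uminus (mset (diag_mat B))"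
    by (simp only: proots_prod_linear_factors mset_map)
  moreover have "proots (char_poly A) = mset (diag_mat B)"
    unfolding char_poly_similar[OF sim] char_poly_upper_triangular[OF B ut]
    by (rule proots_prod_linear_factors)
  ultimately show ?thesis by simp
qed

section \<open>Powers of symmetric matrices and their quadratic forms\<close>

lemma symmetric_mat_pow:
  fixes A :: "'a :: comm_semiring_1 mat"
  assumes A: "A \<in> carrier_mat n n" and sym: "transpose_mat A = A"
  shows "transpose_mat (A ^\<^sub>m k) = A ^\<^sub>m k"
proof (induction k)
  case 0
  show ?case by simp
next
  case (Suc k)
  have comm: "A * A ^\<^sub>m k = A ^\<^sub>m k * A"
    using A by (induction k) (simp_all add: assoc_mult_mat[of _ n n _ n _ n, symmetric])
  show ?case
    using A transpose_mult[of "A ^\<^sub>m k" n n A n] by (simp add: Suc sym comm)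
qed

lemma pow_mat_plus:
  fixes A :: "'a :: semiring_1 mat"
  assumes A: "A \<in> carrier_mat n n"
  shows "A ^\<^sub>m (k + l) = A ^\<^sub>m k * A ^\<^sub>m l"
  using A by (induction l) (simp_all add: assoc_mult_mat[of _ n n _ n _ n])

lemma symmetric_mat_scalar_prod_square:
  fixes B :: "'a :: comm_semiring_0 mat"
  assumes B: "B \<in> carrier_mat n n" and sym: "transpose_mat B = B" and x: "x \<in> carrier_vec n"
  shows "x \<bullet> (B * B *\<^sub>v x) = (B *\<^sub>v x) \<bullet> (B *\<^sub>v x)"
  using transpose_vec_mult_scalar[OF B x, of "B *\<^sub>v x"] B x
  by (simp add: sym comm_scalar_prod[of _ n])

lemma scalar_prod_Cauchy_Schwarz_real:
  fixes x y :: "real vec"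
  assumes "x \<in> carrier_vec n" "y \<in> carrier_vec n"
  shows "(x \<bullet> y)\<^sup>2 \<le> (x \<bullet> x) * (y \<bullet> y)"
  using assms Cauchy_Schwarz_ineq_sum[of "vec_index x" "vec_index y" "{0..<n}"]
  by (simp add: scalar_prod_def power2_eq_square)

lemma scalar_prod_self_nonneg: "0 \<le> x \<bullet> (x :: real vec)"
  by (simp add: scalar_prod_def sum_nonneg)

text \<open>The exponent doubles at each step: with \<open>B = A ^\<^sub>m (2 ^ k)\<close>
  symmetric, Cauchy-Schwarz bounds the square of \<open>x \<bullet> (B *\<^sub>v x)\<close> by
  \<open>x \<bullet> x\<close> times the squared norm of \<open>B *\<^sub>v x\<close>, and the
  latter is the quadratic form of \<open>B * B\<close>.\<close>

lemma symmetric_mat_quadratic_form_power: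
  fixes A :: "real mat"
  assumes A: "A \<in> carrier_mat n n" and sym: "transpose_mat A = A"
    and x: "x \<in> carrier_vec n" and t: "t \<ge> 0" and le: "t * (x \<bullet> x) \<le> x \<bullet> (A *\<^sub>v x)"
  shows "t ^ (2 ^ k) * (x \<bullet> x) \<le> x \<bullet> (A ^\<^sub>m (2 ^ k) *\<^sub>v x)"
proof (induction k)
  case 0
  show ?case using le A by simp
next
  case (Suc k)
  define B where "B = A ^\<^sub>m (2 ^ k)"
  have B: "B \<in> carrier_mat n n" and symB: "transpose_mat B = B"
    unfolding B_def using A symmetric_mat_pow[OF A sym] by auto
  have BB: "A ^\<^sub>m (2 ^ Suc k) = B * B"
    unfolding B_def by (simp add: pow_mat_plus[OF A, symmetric] mult_2)
  define S where "S = x \<bullet> x"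
  have S: "S \<ge> 0" unfolding S_def by (rule scalar_prod_self_nonneg)
  have "S * (t ^ (2 ^ Suc k) * S) = (t ^ (2 ^ k) * S)\<^sup>2"
    by (simp add: power2_eq_square mult_2 power_add mult_ac)
  also have "\<dots> \<le> (x \<bullet> (B *\<^sub>v x))\<^sup>2"
    using Suc S t by (intro power_mono) (auto simp: B_def S_def)
  also have "\<dots> \<le> S * ((B *\<^sub>v x) \<bullet> (B *\<^sub>v x))"
    unfolding S_def using B x by (intro scalar_prod_Cauchy_Schwarz_real[of _ n]) auto
  also have "\<dots> = S * (x \<bullet> (A ^\<^sub>m (2 ^ Suc k) *\<^sub>v x))"
    unfolding BB symmetric_mat_scalar_prod_square[OF B symB x] ..
  finally have *: "S * (t ^ (2 ^ Suc k) * S) \<le> S * (x \<bullet> (A ^\<^sub>m (2 ^ Suc k) *\<^sub>v x))" .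
  show ?case
  proof (cases "S = 0")
    \<comment> \<open>The common factor \<open>S\<close> cannot be cancelled here, but the left side
      is zero and the right side is a squared norm.\<close>
    case True
    then show ?thesis
      unfolding BB symmetric_mat_scalar_prod_square[OF B symB x]
      using scalar_prod_self_nonneg[of "B *\<^sub>v x"] by (simp add: S_def)
  next
    case False
    then show ?thesis using * S unfolding S_def[symmetric] by (simp add: mult_le_cancel_left)
  qed
qed

text \<open>Cauchy-Schwarz applied to each row of \<open>B\<close>. The squared norms of the rows
  add up to the squared Frobenius norm, which for symmetric \<open>B\<close> is the trace of the
  square.\<close>

lemma symmetric_mat_quadratic_form_le_trace:
  fixes B :: "real mat"
  assumes B: "B \<in> carrier_mat n n" and sym: "transpose_mat B = B" and x: "x \<in> carrier_vec n"
  shows "x \<bullet> (B * B *\<^sub>v x) \<le> mat_trace (B * B) * (x \<bullet> x)"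
proof -
  note B_sym = symmetric_mat_index[OF B sym]
  have "x \<bullet> (B * B *\<^sub>v x) = (\<Sum>i<n. (row B i \<bullet> x)\<^sup>2)"
    using B by (simp add: symmetric_mat_scalar_prod_square[OF B sym x] power2_eq_square
        scalar_prod_def[of _ "B *\<^sub>v x"] atLeast0LessThan)
  also have "\<dots> \<le> (\<Sum>i<n. (row B i \<bullet> row B i) * (x \<bullet> x))"
    using B x by (intro sum_mono scalar_prod_Cauchy_Schwarz_real[of _ n]) auto
  also have "(\<Sum>i<n. (row B i \<bullet> row B i) * (x \<bullet> x)) = (\<Sum>i<n. row B i \<bullet> row B i) * (x \<bullet> x)"
    by (simp add: sum_distrib_right)
  also have "(\<Sum>i<n. row B i \<bullet> row B i) = (\<Sum>i<n. \<Sum>j<n. B $$ (i, j) * B $$ (j, i))"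
    unfolding scalar_prod_def using B B_sym by (intro sum.cong) (auto simp: atLeast0LessThan)
  also have "\<dots> = mat_trace (B * B)"
    by (rule mat_trace_mult[OF B B, symmetric])
  finally show ?thesis .
qed

text \<open>A substitute for the Rayleigh principle that avoids orthonormal eigenvectors: by repeated
  Cauchy--Schwarz \<^term>\<open>t ^ (2 ^ k)\<close> is at most the trace of \<^term>\<open>A ^\<^sub>m (2 ^ k)\<close>,
  which would tend to zero relative to \<^term>\<open>t ^ (2 ^ k)\<close> if all eigenvalues were smaller than
  \<^term>\<open>t\<close> in absolute value.\<close>
lemma symmetric_mat_eigenvalue_ge_Rayleigh_quotient:
  fixes A :: "real mat" and x :: "real vec"
  assumes A: "A \<in> carrier_mat n n" and sym: "transpose_mat A = A"
    and es: "char_poly A = (\<Prod>e\<leftarrow>es. [:- e, 1:])"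
    and x: "x \<in> carrier_vec n" "x \<bullet> x > 0" and t: "t > 0" and le: "t * (x \<bullet> x) \<le> x \<bullet> (A *\<^sub>v x)"
  obtains e where "e \<in> set es" "t \<le> \<bar>e\<bar>"
proof (rule ccontr)
  assume "\<not> thesis"
  with that have small: "\<bar>e / t\<bar> < 1" if "e \<in> set es" for e
    using that t by (force simp: not_le)
  \<comment> \<open>The exponent is \<open>2 ^ Suc k\<close> rather than \<open>2 ^ k\<close> so
    that the power is the square of a symmetric matrix, as the trace bound requires.\<close>
  have ge: "1 \<le> (\<Sum>i<length es. (es ! i / t) ^ (2 ^ Suc k))" for k :: nat
  proof -
    define B where "B = A ^\<^sub>m (2 ^ k)"
    have B: "B \<in> carrier_mat n n" and symB: "transpose_mat B = B"
      unfolding B_def using A symmetric_mat_pow[OF A sym] by auto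
    have BB: "A ^\<^sub>m (2 ^ Suc k) = B * B"
      unfolding B_def by (simp add: pow_mat_plus[OF A, symmetric] mult_2)
    have "t ^ (2 ^ Suc k) * (x \<bullet> x) \<le> x \<bullet> (B * B *\<^sub>v x)"
      using symmetric_mat_quadratic_form_power[OF A sym x(1) _ le, of "Suc k"] t unfolding BB by simp
    also have "\<dots> \<le> mat_trace (B * B) * (x \<bullet> x)"
      by (rule symmetric_mat_quadratic_form_le_trace[OF B symB x(1)])
    finally have "t ^ (2 ^ Suc k) \<le> (\<Sum>e\<leftarrow>es. e ^ (2 ^ Suc k))"
      using x(2) unfolding BB[symmetric] mat_trace_pow[OF A es] by simp
    also have "\<dots> = (\<Sum>i<length es. (es ! i) ^ (2 ^ Suc k))"
      by (simp add: sum_list_sum_nth atLeast0LessThan)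
    finally have "1 \<le> (\<Sum>i<length es. (es ! i) ^ (2 ^ Suc k)) / t ^ (2 ^ Suc k)"
      using t by (subst pos_le_divide_eq) auto
    then show ?thesis by (simp only: sum_divide_distrib power_divide)
  qed
  have sub: "strict_mono (\<lambda>k::nat. (2::nat) ^ Suc k)"
    by (rule strict_monoI) (auto intro!: power_strict_increasing)
  \<comment> \<open>Each sequence is a subsequence of the powers of a number of absolute value below
    1, and the number of summands does not depend on \<open>k\<close>.\<close>
  have "(\<lambda>k. (es ! i / t) ^ (2 ^ Suc k)) \<longlonglongrightarrow> 0" if "i < length es" for i
    using LIMSEQ_subseq_LIMSEQ[OF LIMSEQ_abs_realpow_zero2 sub, of "es ! i / t"] small[of "es ! i"] that
    by (simp add: o_def)
  then have "(\<lambda>k. \<Sum>i<length es. (es ! i / t) ^ (2 ^ Suc k)) \<longlonglongrightarrow> (\<Sum>i<length es. 0)"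
    by (intro tendsto_sum) auto
  then have "1 \<le> (0::real)"
    using ge by (intro LIMSEQ_le_const[of _ _ 1]) auto
  then show False by simp
qed

text \<open>Each side says that a sum of squares vanishes, and the two sums agree: expanding either
  one gives the power sums of exponents 6, 4 and 2. Traces thus replace a diagonalization of
  \<open>A\<close>.\<close>

lemma symmetric_mat_cube_eq_smult_iff:
  fixes A :: "real mat"
  assumes A: "A \<in> carrier_mat n n" and sym: "transpose_mat A = A"
    and es: "char_poly A = (\<Prod>e\<leftarrow>es. [:- e, 1:])"
  shows "(\<forall>i<n. \<forall>j<n. (A ^\<^sub>m 3) $$ (i, j) = c * A $$ (i, j)) \<longleftrightarrow> (\<forall>e\<in>set es. e ^ 3 = c * e)"
proof -
  define C where "C = A ^\<^sub>m 3"
  have C: "C \<in> carrier_mat n n" unfolding C_def using A by simp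
  note A_sym = symmetric_mat_index[OF A sym]
  have C_sym: "C $$ (j, i) = C $$ (i, j)" if "i < n" "j < n" for i j
    using that unfolding C_def
    by (intro symmetric_mat_index[OF _ symmetric_mat_pow[OF A sym]]) (simp_all add: A)
  have tr: "mat_trace (A ^\<^sub>m k * A ^\<^sub>m l) = (\<Sum>e\<leftarrow>es. e ^ (k + l))" for k l
    by (simp add: pow_mat_plus[OF A, symmetric] mat_trace_pow[OF A es])
  have A1: "A ^\<^sub>m 1 = A" using A by simp
  have "(\<Sum>i<n. \<Sum>j<n. (C $$ (i, j) - c * A $$ (i, j))\<^sup>2) =
      (\<Sum>i<n. \<Sum>j<n. C $$ (i, j) * C $$ (j, i) - 2 * c * (C $$ (i, j) * A $$ (j, i))
        + c\<^sup>2 * (A $$ (i, j) * A $$ (j, i)))"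
  proof (intro sum.cong refl)
    fix i j assume ij: "i \<in> {..<n}" "j \<in> {..<n}"
    then have "C $$ (j, i) = C $$ (i, j)" "A $$ (j, i) = A $$ (i, j)" using A_sym C_sym by auto
    then show "(C $$ (i, j) - c * A $$ (i, j))\<^sup>2 = C $$ (i, j) * C $$ (j, i)
        - 2 * c * (C $$ (i, j) * A $$ (j, i)) + c\<^sup>2 * (A $$ (i, j) * A $$ (j, i))"
      by (simp add: power2_eq_square algebra_simps)
  qed
  also have "\<dots> = mat_trace (C * C) - 2 * c * mat_trace (C * A) + c\<^sup>2 * mat_trace (A * A)"
    unfolding mat_trace_mult[OF C C] mat_trace_mult[OF C A] mat_trace_mult[OF A A]
    by (simp add: sum.distrib sum_subtractf sum_distrib_left)
  also have "\<dots> = (\<Sum>e\<leftarrow>es. e ^ 6) - 2 * c * (\<Sum>e\<leftarrow>es. e ^ 4) + c\<^sup>2 * (\<Sum>e\<leftarrow>es. e\<^sup>2)"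
    using tr[of 3 3] tr[of 3 1] tr[of 1 1] unfolding A1 C_def by (simp add: numeral_2_eq_2)
  also have "\<dots> = (\<Sum>e\<leftarrow>es. (e ^ 3 - c * e)\<^sup>2)"
    by (induction es) (simp_all add: power2_eq_square power3_eq_cube eval_nat_numeral algebra_simps)
  finally have *: "(\<Sum>i<n. \<Sum>j<n. (C $$ (i, j) - c * A $$ (i, j))\<^sup>2) = (\<Sum>e\<leftarrow>es. (e ^ 3 - c * e)\<^sup>2)" .
  have "(\<forall>i<n. \<forall>j<n. C $$ (i, j) = c * A $$ (i, j)) \<longleftrightarrow>
      (\<Sum>i<n. \<Sum>j<n. (C $$ (i, j) - c * A $$ (i, j))\<^sup>2) = 0"
    by (auto simp: sum_nonneg_eq_0_iff sum_nonneg)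
  also have "\<dots> \<longleftrightarrow> (\<forall>e\<in>set es. e ^ 3 = c * e)"
    unfolding * by (subst sum_list_nonneg_eq_0_iff) auto
  finally show ?thesis unfolding C_def .
qed

lemma pow_mat_3_index:
  fixes A :: "'a :: semiring_1 mat"
  assumes "A \<in> carrier_mat n n" "i < n" "j < n"
  shows "(A ^\<^sub>m 3) $$ (i, j) = (\<Sum>b<n. (\<Sum>a<n. A $$ (i, a) * A $$ (a, b)) * A $$ (b, j))"
  using assms
  by (simp add: numeral_3_eq_3 scalar_prod_def atLeast0LessThan sum_distrib_left sum_distrib_right mult.assoc)
    (rule sum.swap)

section \<open>Hyperbolic cosine sums over symmetric multisets\<close>

lemma sum_mset_exp_eq_cosh:
  fixes M :: "real multiset"
  assumes "image_mset uminus M = M"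
  shows "(\<Sum>x\<in>#M. exp x) = (\<Sum>x\<in>#M. cosh x)"
proof -
  have "(\<Sum>x\<in>#M. exp (- x)) = (\<Sum>x\<in>#image_mset uminus M. exp x)"
    by (simp add: image_mset.compositionality o_def)
  then have "(\<Sum>x\<in>#M. exp (- x)) = (\<Sum>x\<in>#M. exp x)"
    unfolding assms .
  moreover have "2 * (\<Sum>x\<in>#M. cosh x) = (\<Sum>x\<in>#M. exp x) + (\<Sum>x\<in>#M. exp (- x))"
    by (induction M) (simp_all add: cosh_def distrib_left)
  ultimately show ?thesis by (metis mult_2 mult_left_cancel zero_neq_numeral)
qed

lemma sum_mset_cosh_ge_size:
  fixes N :: "real multiset"
  shows "(\<Sum>x\<in>#N. cosh x) \<ge> real (size N)"
    and "(\<Sum>x\<in>#N. cosh x) = real (size N) \<Longrightarrow> x \<in># N \<Longrightarrow> x = 0"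
proof -
  show ge: "(\<Sum>x\<in>#N. cosh x) \<ge> real (size N)" for N :: "real multiset"
    by (induction N) (auto intro: add_mono simp: cosh_real_ge_1)
  show "x = 0" if eq: "(\<Sum>x\<in>#N. cosh x) = real (size N)" and x: "x \<in># N"
  proof -
    from x obtain N' where N: "N = add_mset x N'" by (auto dest: multi_member_split)
    have "cosh x = 1" using eq ge[of N'] cosh_real_ge_1[of x] unfolding N by (simp del: cosh_real_one_iff)
    then show "x = 0" by (simp add: cosh_real_one_iff)
  qed
qed

lemma symmetric_mset_sum_exp_ge:
  fixes M :: "real multiset"
  assumes sym: "image_mset uminus M = M" and e: "e \<in># M" "t \<le> \<bar>e\<bar>" and t: "t > 0"
  shows "(\<Sum>x\<in>#M. exp x) \<ge> 2 * cosh t + (real (size M) - 2)"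
    and "(\<Sum>x\<in>#M. exp x) = 2 * cosh t + (real (size M) - 2) \<Longrightarrow>
      \<exists>N. M = {#t, - t#} + N \<and> (\<forall>x\<in>#N. x = 0)"
proof -
  define s where "s = \<bar>e\<bar>"
  have s: "s \<ge> t" "s > 0" using e t by (auto simp: s_def)
  have neg: "- x \<in># M" if "x \<in># M" for x
    using that by (subst sym[symmetric]) auto
  from neg[OF e(1)] e(1) have mem: "s \<in># M" "- s \<in># M"
    by (auto simp: s_def abs_if)
  from mem(1) obtain M' where M': "M = add_mset s M'" by (auto dest: multi_member_split)
  \<comment> \<open>Since \<open>s > 0\<close>, \<open>s\<close> and \<open>- s\<close> are
    different, so the second one survives the removal of the first.\<close>
  from mem(2) s have "- s \<in># M'" unfolding M' by auto
  then obtain N where N: "M' = add_mset (- s) N" by (auto dest: multi_member_split)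
  have M: "M = {#s, - s#} + N" unfolding M' N by simp
  have sum: "(\<Sum>x\<in>#M. exp x) = 2 * cosh s + (\<Sum>x\<in>#N. cosh x)"
    unfolding sum_mset_exp_eq_cosh[OF sym] unfolding M by simp
  have size: "real (size M) - 2 = real (size N)" unfolding M by simp
  have mono: "cosh t \<le> cosh s" using s t by (subst cosh_real_nonneg_le_iff) auto
  show "(\<Sum>x\<in>#M. exp x) \<ge> 2 * cosh t + (real (size M) - 2)"
    unfolding sum size using mono sum_mset_cosh_ge_size(1)[of N] by simp
  show "\<exists>N. M = {#t, - t#} + N \<and> (\<forall>x\<in>#N. x = 0)"
    if "(\<Sum>x\<in>#M. exp x) = 2 * cosh t + (real (size M) - 2)"
  proof -
    \<comment> \<open>Equality in the sum of two lower bounds forces equality in each of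
      them.\<close>
    from that have eq: "cosh s = cosh t" "(\<Sum>x\<in>#N. cosh x) = real (size N)"
      unfolding sum size using mono sum_mset_cosh_ge_size(1)[of N] by linarith+
    have "s = t"
      using eq(1) s t cosh_real_nonneg_less_iff[of t s] by force
    then show ?thesis using M sum_mset_cosh_ge_size(2)[OF eq(2)] by blast
  qed
qed

lemma symmetric_mset_sum_exp_eq:
  fixes M :: "real multiset"
  assumes sym: "image_mset uminus M = M" and t: "t > 0"
    and root: "\<And>x. x \<in># M \<Longrightarrow> x ^ 3 = t\<^sup>2 * x" and sq: "(\<Sum>x\<in>#M. x\<^sup>2) = 2 * t\<^sup>2"
  shows "(\<Sum>x\<in>#M. exp x) = 2 * cosh t + (real (size M) - 2)"
proof -
  \<comment> \<open>The affine function of \<open>x\<^sup>2\<close> is the one with value 1 at 0 and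
    \<open>cosh t\<close> at \<open>t\<^sup>2\<close>; the cubic equation allows only
    \<open>0\<close>, \<open>t\<close> and \<open>- t\<close> for \<open>x\<close>.\<close>
  have cosh: "cosh x = 1 + (cosh t - 1) / t\<^sup>2 * x\<^sup>2" if "x \<in># M" for x
  proof -
    have "x * (x - t) * (x + t) = 0"
      using root[OF that] by (simp add: algebra_simps power2_eq_square power3_eq_cube)
    then have "x = 0 \<or> x = t \<or> x = - t" by auto
    then show ?thesis using t by auto
  qed
  have "(\<Sum>x\<in>#M. exp x) = (\<Sum>x\<in>#M. 1 + (cosh t - 1) / t\<^sup>2 * x\<^sup>2)"
    unfolding sum_mset_exp_eq_cosh[OF sym] by (simp add: cosh cong: image_mset_cong)
  also have "\<dots> = real (size M) + (cosh t - 1) / t\<^sup>2 * (\<Sum>x\<in>#M. x\<^sup>2)"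
    by (induction M) (simp_all add: algebra_simps)
  also have "\<dots> = 2 * cosh t + (real (size M) - 2)"
    using t unfolding sq by simp
  finally show ?thesis .
qed

section \<open>Spectra of bipartite graphs\<close>

lemma adj_matrix_carrier [simp]: "adj_matrix n E \<in> carrier_mat n n"
  by (simp add: adj_matrix_def)

lemma adj_matrix_dim [simp]: "dim_row (adj_matrix n E) = n" "dim_col (adj_matrix n E) = n"
  by (simp_all add: adj_matrix_def)

lemma adj_matrix_index [simp]:
  "i < n \<Longrightarrow> j < n \<Longrightarrow> adj_matrix n E $$ (i, j) = (if E i j then 1 else 0)"
  by (simp add: adj_matrix_def)

lemma transpose_adj_matrix:
  assumes "simple_graph n E"
  shows "transpose_mat (adj_matrix n E) = adj_matrix n E"
  using assms by (intro eq_matI) (auto simp: adj_matrix_def simple_graph_def)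

text \<open>Conjugating by the diagonal matrix with sign 1 on one colour class and -1 on the other
  negates every entry that belongs to an edge. Hence the adjacency matrix is similar to its
  negative.\<close>

lemma adj_eigenvalues_uminus:
  assumes simple: "simple_graph n E" and bip: "bipartite_graph n E"
  shows "image_mset uminus (adj_eigenvalues n E) = adj_eigenvalues n E"
proof -
  let ?A = "adj_matrix n E"
  from bip obtain X where X: "\<And>i j. E i j \<Longrightarrow> i \<in> X \<longleftrightarrow> j \<notin> X"
    unfolding bipartite_graph_def by blast
  define s :: "nat \<Rightarrow> real" where "s i = (if i \<in> X then 1 else - 1)" for i
  define D where "D = mat_diag n s"
  have D: "D \<in> carrier_mat n n" by (simp add: D_def)
  have DD: "D * D = 1\<^sub>m n"
    by (auto simp: D_def s_def mat_diag_def mat_diag_diag[unfolded mat_diag_def] intro!: eq_matI)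
  have "- ?A = D * ?A * D"
    unfolding D_def mat_diag_mult_left[OF adj_matrix_carrier] mat_diag_mult_right[OF mat_carrier]
    by (intro eq_matI) (auto simp: s_def adj_matrix_def dest: X)
  then have "similar_mat (- ?A) ?A"
    using D DD by (intro similar_matI[of _ _ D D n]) auto
  then have "char_poly (- ?A) = char_poly ?A"
    by (rule char_poly_similar)
  moreover obtain es where "char_poly ?A = (\<Prod>e\<leftarrow>es. [:- e, 1:])"
    using symmetric_mat_char_poly_splits[OF adj_matrix_carrier transpose_adj_matrix[OF simple]] by blast
  ultimately show ?thesis
    using proots_char_poly_uminus[OF adj_matrix_carrier] unfolding adj_eigenvalues_def by metis
qed

section \<open>Edge sums, degrees and the Rayleigh quotient of the test vector\<close>

lemma finite_edges: "finite (edges n E)"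
  by (rule finite_subset[of _ "{..<n} \<times> {..<n}"]) (auto simp: edges_def)

text \<open>Passes from matrix sums over ordered pairs to sums over \<open>edges\<close>, which
  lists each edge once with its smaller end first; the swapped copy supplies the other half.\<close>

lemma sum_edges_symmetric:
  fixes f :: "nat \<Rightarrow> nat \<Rightarrow> real"
  assumes simple: "simple_graph n E" and sym: "\<And>i j. f i j = f j i"
  shows "(\<Sum>i<n. \<Sum>j<n. if E i j then f i j else 0) = 2 * (\<Sum>(i, j)\<in>edges n E. f i j)"
proof -
  let ?S = "{(i, j). E i j}"
  have S: "?S = edges n E \<union> prod.swap ` edges n E"
    using simple by (force simp: edges_def simple_graph_def image_iff)
  have disj: "edges n E \<inter> prod.swap ` edges n E = {}"
    by (auto simp: edges_def)
  have "(\<Sum>i<n. \<Sum>j<n. if E i j then f i j else 0) = (\<Sum>p\<in>{..<n} \<times> {..<n}. if p \<in> ?S then f (fst p) (snd p) else 0)"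
    by (simp add: sum.cartesian_product case_prod_unfold)
  also have "\<dots> = (\<Sum>(i, j)\<in>?S. f i j)"
    using simple by (subst sum.inter_restrict[symmetric])
      (auto simp: simple_graph_def case_prod_unfold intro!: sum.cong)
  also have "\<dots> = (\<Sum>(i, j)\<in>edges n E. f i j) + (\<Sum>(i, j)\<in>prod.swap ` edges n E. f i j)"
    unfolding S by (intro sum.union_disjoint finite_edges finite_imageI disj)
  also have "(\<Sum>(i, j)\<in>prod.swap ` edges n E. f i j) = (\<Sum>(i, j)\<in>edges n E. f i j)"
    by (subst sum.reindex) (auto simp: sym inj_on_def case_prod_unfold intro!: sum.cong)
  finally show ?thesis by simp
qed

lemma real_vdeg: "real (vdeg n E i) = (\<Sum>j<n. if E i j then 1 else 0)"
proof -
  have "{j. j < n \<and> E i j} = {..<n} \<inter> {j. E i j}" by auto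
  then show ?thesis by (simp add: vdeg_def sum.If_cases)
qed

lemma sum_vdeg_eq_num_edges:
  assumes "simple_graph n E"
  shows "(\<Sum>i<n. real (vdeg n E i)) = 2 * real (num_edges n E)"
  using sum_edges_symmetric[OF assms, of "\<lambda>_ _. 1"] by (simp add: real_vdeg num_edges_def)

lemma vdeg_pos:
  assumes "simple_graph n E" "E i j"
  shows "vdeg n E i > 0"
  using assms by (auto simp: vdeg_def card_gt_0_iff simple_graph_def)

lemma edges_nonempty:
  assumes "simple_graph n E" "connected_graph n E" "n \<ge> 2"
  shows "edges n E \<noteq> {}"
proof -
  have "E\<^sup>*\<^sup>* 0 1" using assms by (simp add: connected_graph_def)
  then obtain j where "E 0 j" by (metis converse_rtranclpE zero_neq_one)
  then have "(0, j) \<in> edges n E" using assms(1) by (force simp: edges_def simple_graph_def)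
  then show ?thesis by auto
qed

lemma num_edges_randic_index_pos:
  assumes "simple_graph n E" "connected_graph n E" "n \<ge> 2"
  shows "num_edges n E > 0" "randic_index n E > 0"
proof -
  show "num_edges n E > 0"
    using edges_nonempty[OF assms] by (simp add: num_edges_def card_gt_0_iff finite_edges)
  have pos: "vdeg n E i > 0" "vdeg n E j > 0" if "(i, j) \<in> edges n E" for i j
    using that assms(1) vdeg_pos[OF assms(1)] by (auto simp: edges_def simple_graph_def)
  show "randic_index n E > 0"
    unfolding randic_index_def using pos
    by (intro sum_pos finite_edges edges_nonempty[OF assms]) auto
qed

text \<open>The vector of square roots of the degrees has Rayleigh quotient \<open>Q / m\<close>, where \<open>Q\<close> sums
  the square roots of \<open>d(i) d(j)\<close> over the edges; Cauchy--Schwarz over the edges gives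
  \<open>m ^ 2 \<le> R * Q\<close>.\<close>
lemma sqrt_vdeg_Rayleigh_quotient:
  assumes simple: "simple_graph n E" and conn: "connected_graph n E" and n: "n \<ge> 2"
  defines "x \<equiv> vec n (\<lambda>i. sqrt (real (vdeg n E i)))"
  shows "x \<bullet> x > 0"
    and "real (num_edges n E) / randic_index n E * (x \<bullet> x) \<le> x \<bullet> (adj_matrix n E *\<^sub>v x)"
proof -
  define m where "m = real (num_edges n E)"
  define R where "R = randic_index n E"
  have pos: "m > 0" "R > 0"
    unfolding m_def R_def using num_edges_randic_index_pos[OF simple conn n] by auto
  define Q where "Q = (\<Sum>(i, j)\<in>edges n E. sqrt (real (vdeg n E i * vdeg n E j)))"
  have xx: "x \<bullet> x = 2 * m"
    using sum_vdeg_eq_num_edges[OF simple]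
    by (simp add: x_def m_def scalar_prod_def atLeast0LessThan)
  then show "x \<bullet> x > 0" using pos by simp
  have "x \<bullet> (adj_matrix n E *\<^sub>v x) =
      (\<Sum>i<n. \<Sum>j<n. if E i j then sqrt (real (vdeg n E i * vdeg n E j)) else 0)"
    by (auto simp: x_def scalar_prod_def atLeast0LessThan sum_distrib_left real_sqrt_mult
        intro!: sum.cong)
  also have "\<dots> = 2 * Q"
    unfolding Q_def by (intro sum_edges_symmetric[OF simple]) (simp add: mult.commute)
  finally have xAx: "x \<bullet> (adj_matrix n E *\<^sub>v x) = 2 * Q" .
  \<comment> \<open>Fourth roots of the degree products are the weights, so that the squares of
    \<open>?a\<close> sum to \<open>Q\<close> and those of \<open>1 / ?a\<close> sum to
    \<open>R\<close>, while each product is 1.\<close>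
  let ?a = "\<lambda>(i, j). sqrt (sqrt (real (vdeg n E i * vdeg n E j)))"
  have deg: "vdeg n E i > 0" "vdeg n E j > 0" if "(i, j) \<in> edges n E" for i j
    using that simple vdeg_pos[OF simple] by (auto simp: edges_def simple_graph_def)
  have "?a p \<noteq> 0" if "p \<in> edges n E" for p
    using deg that by (cases p) auto
  then have "(\<Sum>p\<in>edges n E. (1 / ?a p) * ?a p) = (\<Sum>p\<in>edges n E. 1)"
    by (intro sum.cong refl) simp
  then have "m = (\<Sum>p\<in>edges n E. (1 / ?a p) * ?a p)"
    by (simp add: m_def num_edges_def)
  then have "m\<^sup>2 = (\<Sum>p\<in>edges n E. (1 / ?a p) * ?a p)\<^sup>2" by simp
  also have "\<dots> \<le> (\<Sum>p\<in>edges n E. (1 / ?a p)\<^sup>2) * (\<Sum>p\<in>edges n E. (?a p)\<^sup>2)"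
    by (rule Cauchy_Schwarz_ineq_sum)
  also have "\<dots> = R * Q"
    unfolding R_def Q_def randic_index_def
    by (simp add: case_prod_unfold power_divide)
  finally show "real (num_edges n E) / randic_index n E * (x \<bullet> x) \<le> x \<bullet> (adj_matrix n E *\<^sub>v x)"
    unfolding xx xAx using pos by (simp add: m_def[symmetric] R_def[symmetric] field_simps power2_eq_square)
qed

section \<open>Complete bipartite graphs and the case of equality\<close>

lemma path3_closed_imp_complete:
  assumes conn: "connected_graph n E" and bip: "\<And>i j. E i j \<Longrightarrow> i \<in> X \<longleftrightarrow> j \<notin> X"
    and path: "\<And>i a b j. E i a \<Longrightarrow> E a b \<Longrightarrow> E b j \<Longrightarrow> E i j"
    and ij: "i < n" "j < n" "(i \<in> X) \<noteq> (j \<in> X)"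
  shows "E i j"
proof -
  have "E\<^sup>*\<^sup>* i j" using conn ij by (simp add: connected_graph_def)
  \<comment> \<open>Distance at most two from \<open>i\<close> is preserved along a walk, because
    \<open>path\<close> shortcuts any three consecutive edges to one. Vertices of different colour
    can be neither equal nor joined by two edges.\<close>
  then have "i = j \<or> E i j \<or> (\<exists>b. E i b \<and> E b j)"
    by induction (blast intro: path)+
  then show ?thesis using ij bip by blast
qed

text \<open>Trades the relabelling for a colour class \<open>X\<close>: forwards \<open>X\<close> is
  the preimage of the labels below \<open>p\<close>; backwards, bijections of the two classes onto
  \<open>{0..<p}\<close> and \<open>{p..<p + q}\<close> are glued together.\<close>

lemma graph_iso_complete_bipartite_iff:
  assumes "simple_graph n E"
  shows "graph_iso n E (p + q) (complete_bipartite p q) \<longleftrightarrow>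
    (\<exists>X. X \<subseteq> {..<n} \<and> card X = p \<and> card ({..<n} - X) = q \<and>
      (\<forall>i j. E i j \<longleftrightarrow> i < n \<and> j < n \<and> (i \<in> X) \<noteq> (j \<in> X)))" (is "_ \<longleftrightarrow> ?rhs")
proof
  assume "graph_iso n E (p + q) (complete_bipartite p q)"
  then obtain f where f: "bij_betw f {0..<n} {0..<p + q}"
    and E: "\<And>i j. i < n \<Longrightarrow> j < n \<Longrightarrow> E i j \<longleftrightarrow> complete_bipartite p q (f i) (f j)"
    unfolding graph_iso_def by blast
  have f_less: "f i < p + q" if "i < n" for i
    using bij_betwE[OF f] that by auto
  define X where "X = {i. i < n \<and> f i < p}"
  have "bij_betw f X {0..<p}"
  proof (rule bij_betw_subset[OF f])
    show "X \<subseteq> {0..<n}" by (auto simp: X_def)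
    have "y \<in> f ` X" if "y < p" for y
    proof -
      have "y \<in> f ` {0..<n}" using that unfolding bij_betw_imp_surj_on[OF f] by simp
      then show ?thesis using that by (auto simp: X_def)
    qed
    then show "f ` X = {0..<p}" by (auto simp: X_def)
  qed
  then have "card X = p" using bij_betw_same_card by fastforce
  moreover have "card {..<n} = p + q"
    using bij_betw_same_card[OF f] by simp
  then have "card ({..<n} - X) = q"
    using \<open>card X = p\<close> by (subst card_Diff_subset) (auto simp: X_def)
  moreover have "E i j \<longleftrightarrow> i < n \<and> j < n \<and> (i \<in> X) \<noteq> (j \<in> X)" for i j
  proof (cases "i < n \<and> j < n")
    case True
    then show ?thesis
      using E[of i j] f_less[of i] f_less[of j] by (auto simp: complete_bipartite_def X_def)
  next
    case False
    then show ?thesis using assms by (auto simp: simple_graph_def)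
  qed
  ultimately show ?rhs by (intro exI[of _ X]) (auto simp: X_def)
next
  assume ?rhs
  then obtain X where X: "X \<subseteq> {..<n}" "card X = p" "card ({..<n} - X) = q"
    and E: "\<And>i j. E i j \<longleftrightarrow> i < n \<and> j < n \<and> (i \<in> X) \<noteq> (j \<in> X)" by blast
  have finX: "finite X" using X(1) finite_subset by blast
  obtain g where g: "bij_betw g X {0..<p}"
    using finite_same_card_bij[OF finX, of "{0..<p}"] X by auto
  obtain h where h: "bij_betw h ({..<n} - X) {p..<p + q}"
    using finite_same_card_bij[of "{..<n} - X" "{p..<p + q}"] X by auto
  define f where "f i = (if i \<in> X then g i else h i)" for i
  have "bij_betw f X {0..<p}"
    using g by (rule bij_betw_cong[THEN iffD1, rotated]) (simp add: f_def)
  moreover have "bij_betw f ({..<n} - X) {p..<p + q}"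
    using h by (rule bij_betw_cong[THEN iffD1, rotated]) (simp add: f_def)
  ultimately have "bij_betw f (X \<union> ({..<n} - X)) ({0..<p} \<union> {p..<p + q})"
    by (rule bij_betw_combine) auto
  then have f: "bij_betw f {0..<n} {0..<p + q}"
    using X(1) by (simp add: Un_absorb1 ivl_disj_un atLeast0LessThan)
  have "f i < p \<longleftrightarrow> i \<in> X" "p \<le> f i \<longleftrightarrow> i \<notin> X" "f i < p + q" if "i < n" for i
    using that bij_betwE[OF g] bij_betwE[OF h] by (force simp: f_def)+
  then show "graph_iso n E (p + q) (complete_bipartite p q)"
    unfolding graph_iso_def using f E
    by (intro exI[of _ f]) (auto simp: complete_bipartite_def)
qed

lemma estrada_index_eq_imp_complete_bipartite:
  assumes simple: "simple_graph n E" and conn: "connected_graph n E" and bip: "bipartite_graph n E"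
    and n: "n \<ge> 2" and t: "t > 0"
    and N: "adj_eigenvalues n E = {#t, - t#} + N" "\<forall>x\<in>#N. x = 0"
  shows "\<exists>p q. p \<ge> 1 \<and> q \<ge> 1 \<and> p + q = n \<and> graph_iso n E (p + q) (complete_bipartite p q)"
proof -
  let ?A = "adj_matrix n E"
  note sym = transpose_adj_matrix[OF simple]
  obtain es where es: "char_poly ?A = (\<Prod>e\<leftarrow>es. [:- e, 1:])"
    using symmetric_mat_char_poly_splits[OF adj_matrix_carrier sym] by blast
  have "mset es = {#t, - t#} + N"
    using N(1) unfolding adj_eigenvalues_def es proots_prod_linear_factors .
  then have "set es = set_mset ({#t, - t#} + N)" by (metis set_mset_mset)
  then have "\<forall>e\<in>set es. e ^ 3 = t\<^sup>2 * e"
    using N(2) by (auto simp: power2_eq_square power3_eq_cube)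
  then have cube: "(?A ^\<^sub>m 3) $$ (i, j) = t\<^sup>2 * ?A $$ (i, j)" if "i < n" "j < n" for i j
    using symmetric_mat_cube_eq_smult_iff[OF adj_matrix_carrier sym es] that by blast
  have path: "E i j" if walk: "E i a" "E a b" "E b j" for i a b j
  proof -
    have less: "i < n" "a < n" "b < n" "j < n"
      using walk simple by (auto simp: simple_graph_def)
    have nonneg: "0 \<le> ?A $$ (k, l)" if "k < n" "l < n" for k l
      using that by simp
    \<comment> \<open>Entries of the cube count walks of length three. All terms are nonnegative and
      the given walk contributes a positive one, so the entry of \<open>?A\<close> itself cannot
      vanish.\<close>
    have "0 < (\<Sum>a<n. ?A $$ (i, a) * ?A $$ (a, b))"
      using less walk by (intro sum_pos2[of _ a]) (simp_all add: nonneg)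
    then have "0 < (\<Sum>b<n. (\<Sum>a<n. ?A $$ (i, a) * ?A $$ (a, b)) * ?A $$ (b, j))"
      using less walk by (intro sum_pos2[of _ b]) (simp_all add: nonneg sum_nonneg)
    then have "0 < t\<^sup>2 * ?A $$ (i, j)"
      unfolding pow_mat_3_index[OF adj_matrix_carrier less(1,4), symmetric] cube[OF less(1,4)] .
    then show ?thesis using less by (auto split: if_splits)
  qed
  from bip obtain X where X: "\<And>i j. E i j \<Longrightarrow> i \<in> X \<longleftrightarrow> j \<notin> X"
    unfolding bipartite_graph_def by blast
  \<comment> \<open>\<open>X\<close> is an arbitrary set of naturals; cutting it down to the
    vertices makes its cardinality meaningful.\<close>
  define Y where "Y = X \<inter> {..<n}"
  have E: "E i j \<longleftrightarrow> i < n \<and> j < n \<and> (i \<in> Y) \<noteq> (j \<in> Y)" for i j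
  proof
    assume "E i j"
    then show "i < n \<and> j < n \<and> (i \<in> Y) \<noteq> (j \<in> Y)"
      using X[of i j] simple unfolding simple_graph_def Y_def by blast
  next
    assume ij: "i < n \<and> j < n \<and> (i \<in> Y) \<noteq> (j \<in> Y)"
    show "E i j"
    proof (rule path3_closed_imp_complete[OF conn])
      show "k \<in> X \<longleftrightarrow> l \<notin> X" if "E k l" for k l by (rule X[OF that])
      show "E k l" if "E k a" "E a b" "E b l" for k a b l by (rule path[OF that])
    qed (use ij in \<open>auto simp: Y_def\<close>)
  qed
  obtain i j where "E i j" using edges_nonempty[OF simple conn n] by (auto simp: edges_def)
  \<comment> \<open>The two ends of an edge lie in different classes, so neither class is
    empty.\<close>
  then have "Y \<noteq> {}" "{..<n} - Y \<noteq> {}" using E by blast+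
  then have "card Y \<ge> 1" "card ({..<n} - Y) \<ge> 1"
    by (simp_all add: Suc_le_eq card_gt_0_iff Y_def)
  moreover have "card Y + card ({..<n} - Y) = n"
    using card_Diff_subset[of Y "{..<n}"] card_mono[of "{..<n}" Y] by (simp add: Y_def)
  moreover have "graph_iso n E (card Y + card ({..<n} - Y))
      (complete_bipartite (card Y) (card ({..<n} - Y)))"
    unfolding graph_iso_complete_bipartite_iff[OF simple] using E
    by (intro exI[of _ Y]) (auto simp: Y_def)
  ultimately show ?thesis by blast
qed

lemma complete_bipartite_estrada_index:
  assumes simple: "simple_graph n E" and conn: "connected_graph n E" and bip: "bipartite_graph n E"
    and n: "n \<ge> 2" and pq: "p \<ge> 1" "q \<ge> 1"
    and iso: "graph_iso n E (p + q) (complete_bipartite p q)"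
  shows "estrada_index n E = 2 * cosh (real (num_edges n E) / randic_index n E) + (real n - 2)"
proof -
  let ?A = "adj_matrix n E"
  note sym = transpose_adj_matrix[OF simple]
  obtain es where es: "char_poly ?A = (\<Prod>e\<leftarrow>es. [:- e, 1:])" and len: "length es = n"
    using symmetric_mat_char_poly_splits[OF adj_matrix_carrier sym] by blast
  have M: "adj_eigenvalues n E = mset es"
    unfolding adj_eigenvalues_def es by (rule proots_prod_linear_factors)
  from iso obtain X where X: "X \<subseteq> {..<n}" "card X = p" "card ({..<n} - X) = q"
    and E: "\<And>i j. E i j \<longleftrightarrow> i < n \<and> j < n \<and> (i \<in> X) \<noteq> (j \<in> X)"
    unfolding graph_iso_complete_bipartite_iff[OF simple] by blast
  define t where "t = sqrt (real (p * q))"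
  have t: "t > 0" "t\<^sup>2 = real (p * q)" using pq by (auto simp: t_def)
  have deg: "vdeg n E i = (if i \<in> X then q else p)" if "i < n" for i
  proof (cases "i \<in> X")
    case True
    then have "{j. j < n \<and> E i j} = {..<n} - X" using E that by auto
    then show ?thesis using True X by (simp add: vdeg_def)
  next
    case False
    then have "{j. j < n \<and> E i j} = X" using E that X(1) by auto
    then show ?thesis using False X by (simp add: vdeg_def)
  qed
  have deg_mult: "vdeg n E i * vdeg n E j = p * q" if "E i j" for i j
    using that deg[of i] deg[of j] E[of i j] by auto
  \<comment> \<open>Every edge joins a vertex of degree \<open>p\<close> to one of degree
    \<open>q\<close>, so all summands equal \<open>1 / t\<close> and \<open>m / R\<close> is exactly
    \<open>t\<close>.\<close>
  have "randic_index n E = (\<Sum>(i, j)\<in>edges n E. 1 / t)"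
    unfolding randic_index_def t_def by (intro sum.cong) (auto simp: edges_def deg_mult simp del: of_nat_mult)
  then have "randic_index n E = real (num_edges n E) / t"
    by (simp add: num_edges_def case_prod_unfold)
  then have quot: "real (num_edges n E) / randic_index n E = t"
    using num_edges_randic_index_pos[OF simple conn n] t by simp
  have cube: "(?A ^\<^sub>m 3) $$ (i, j) = t\<^sup>2 * ?A $$ (i, j)" if ij: "i < n" "j < n" for i j
  proof -
    \<comment> \<open>Counts common neighbours: vertices of the same class have identical
      neighbourhoods, and vertices of different classes share no neighbour.\<close>
    have two: "(\<Sum>a<n. ?A $$ (i, a) * ?A $$ (a, b)) = (if (i \<in> X) = (b \<in> X) then real (vdeg n E i) else 0)"
      if "b < n" for b
      using ij that by (auto simp: real_vdeg E intro!: sum.cong sum.neutral)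
    have "(?A ^\<^sub>m 3) $$ (i, j) = (\<Sum>b<n. (if (i \<in> X) = (b \<in> X) then real (vdeg n E i) else 0) * ?A $$ (b, j))"
      unfolding pow_mat_3_index[OF adj_matrix_carrier ij] by (intro sum.cong refl) (simp only: two lessThan_iff)
    \<comment> \<open>If \<open>b\<close> is adjacent to \<open>j\<close>, then \<open>b\<close>
      lies in the class of \<open>i\<close> exactly when \<open>i\<close> is adjacent to
      \<open>j\<close>. This lets the class condition be replaced by the factor
      \<open>?A $$ (i, j)\<close>.\<close>
    also have "\<dots> = (\<Sum>b<n. real (vdeg n E i) * ?A $$ (i, j) * (if E j b then 1 else 0))"
      using ij by (intro sum.cong) (auto simp: E)
    also have "\<dots> = real (vdeg n E i) * ?A $$ (i, j) * real (vdeg n E j)"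
      by (simp add: real_vdeg sum_distrib_left)
    also have "\<dots> = t\<^sup>2 * ?A $$ (i, j)"
      using deg_mult[of i j] ij by (auto simp: t simp flip: of_nat_mult)
    finally show ?thesis .
  qed
  have "mat_trace (?A ^\<^sub>m 2) = (\<Sum>i<n. \<Sum>j<n. ?A $$ (i, j) * ?A $$ (j, i))"
    using mat_trace_mult[OF adj_matrix_carrier[of n E] adj_matrix_carrier[of n E]]
    by (simp add: numeral_2_eq_2 carrier_matD[OF adj_matrix_carrier])
  also have "\<dots> = (\<Sum>i<n. real (vdeg n E i))"
    by (auto simp: real_vdeg E intro!: sum.cong)
  also have "\<dots> = (\<Sum>i<n. if i \<in> X then real q else real p)"
    by (intro sum.cong) (auto simp: deg)
  \<comment> \<open>There are \<open>p\<close> vertices of degree \<open>q\<close> and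
    \<open>q\<close> of degree \<open>p\<close>, which gives \<open>2 * p * q\<close>.\<close>
  also have "\<dots> = 2 * t\<^sup>2"
    using X by (simp add: sum.If_cases Int_absorb1 t Diff_eq[symmetric])
  finally have "(\<Sum>x\<in>#adj_eigenvalues n E. x\<^sup>2) = 2 * t\<^sup>2"
    unfolding mat_trace_pow[OF adj_matrix_carrier es] M by (simp flip: sum_mset_sum_list)
  moreover have "x ^ 3 = t\<^sup>2 * x" if "x \<in># adj_eigenvalues n E" for x
    using symmetric_mat_cube_eq_smult_iff[OF adj_matrix_carrier sym es] cube that M by auto
  ultimately show ?thesis
    using symmetric_mset_sum_exp_eq[OF adj_eigenvalues_uminus[OF simple bip] t(1)]
    unfolding estrada_index_def quot by (simp add: M len)
qed

theorem mainTheorem8: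
  fixes n :: nat and E :: "nat \<Rightarrow> nat \<Rightarrow> bool"
  assumes "simple_graph n E" and "connected_graph n E" and "bipartite_graph n E"
    and "n \<ge> 2"
  shows "estrada_index n E \<ge>
           2 * cosh (real (num_edges n E) / randic_index n E) + (real n - 2) \<and>
         (estrada_index n E =
           2 * cosh (real (num_edges n E) / randic_index n E) + (real n - 2) \<longleftrightarrow>
         (\<exists>p q. p \<ge> 1 \<and> q \<ge> 1 \<and> p + q = n \<and> graph_iso n E (p + q) (complete_bipartite p q)))"
proof -
  let ?A = "adj_matrix n E"
  define t where "t = real (num_edges n E) / randic_index n E"
  have t: "t > 0" unfolding t_def using num_edges_randic_index_pos[OF assms(1,2,4)] by simp
  note sym = transpose_adj_matrix[OF assms(1)]
  obtain es where es: "char_poly ?A = (\<Prod>e\<leftarrow>es. [:- e, 1:])" and len: "length es = n"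
    using symmetric_mat_char_poly_splits[OF adj_matrix_carrier sym] by blast
  have M: "adj_eigenvalues n E = mset es"
    unfolding adj_eigenvalues_def es by (rule proots_prod_linear_factors)
  then have size: "size (adj_eigenvalues n E) = n" using len by simp
  \<comment> \<open>Only the absolute value of \<open>e\<close> is controlled, which suffices
    because the spectrum is symmetric.\<close>
  obtain e where "e \<in> set es" "t \<le> \<bar>e\<bar>"
    using symmetric_mat_eigenvalue_ge_Rayleigh_quotient[OF adj_matrix_carrier sym es vec_carrier
        sqrt_vdeg_Rayleigh_quotient(1)[OF assms(1,2,4)] t]
      sqrt_vdeg_Rayleigh_quotient(2)[OF assms(1,2,4)] unfolding t_def by blast
  then have e: "e \<in># adj_eigenvalues n E" "t \<le> \<bar>e\<bar>" by (simp_all add: M)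
  note bound = symmetric_mset_sum_exp_ge[OF adj_eigenvalues_uminus[OF assms(1,3)] e t,
      unfolded size, folded estrada_index_def]
  show ?thesis
    using bound estrada_index_eq_imp_complete_bipartite[OF assms t]
      complete_bipartite_estrada_index[OF assms]
    unfolding t_def[symmetric] by blast
qed

end
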